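(* Let $n$ be a positive integer. Then (1) $H^0(\mathcal{L}_n,\overline{\nabla})=0$, and (2) $H^0(\mathcal{L}_{-n},\overline{\nabla})\simeq\mathbb{C}^{n+1}$. Moreover the same results hold for continuous sections: the space of continuous holomorphic sections of $\Gamma(\mathcal{L}_n)$ is $0$ and that of $\Gamma(\mathcal{L}_{-n})$ is isomorphic to $\mathbb{C}^{n+1}$.
   Context: Fix $0<q<1$, write $[s]=(q^{-s}-q^{s})/(q^{-1}-q)$. Let $\mathcal{A}(SU_q(2))$ be the unital complex $*$-algebra generated by $a,c$ subject to $ac=qca$, $ac^*=qc^*a$, $cc^*=c^*c$, $a^*a+c^*c=aa^*+q^2cc^*=1$, and $C(SU_q(2))$ its universal $C^*$-completion. Let $U_q(su(2))$ be the Hopf algebra generated by $K,K^{-1},E,F$ with $KK^{-1}=K^{-1}K=1$, $KE=qEK$, $KF=q^{-1}FK$, $EF-FE=(K^2-K^{-2})/(q-q^{-1})$, coproduct $\Delta K=K\otimes K$, $\Delta E=E\otimes K+K^{-1}\otimes E$, $\Delta F=F\otimes K+K^{-1}\otimes F$, counit $\epsilon(K)=1,\epsilon(E)=\epsilon(F)=0$. It acts on $\mathcal{A}(SU_q(2))$ from the left making it a left module algebra, with $K\triangleright a=q^{-1/2}a$, $K\triangleright c=q^{-1/2}c$, $K\triangleright a^*=q^{1/2}a^*$, $K\triangleright c^*=q^{1/2}c^*$, $E\triangleright a=-qc^*$, $E\triangleright c=a^*$, $E\triangleright a^*=E\triangleright c^*=0$, $F\triangleright a=F\triangleright c=0$,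 $F\triangleright a^*=c$, $F\triangleright c^*=-q^{-1}a$. Put $X_-=q^{-1/2}FK$. For $k\in\mathbb{Z}$ let $\mathcal{L}_k=\{x\in\mathcal{A}(SU_q(2)):K\triangleright x=q^{k/2}x\}$, a bimodule over $\mathcal{A}(\mathbb{CP}^1_q):=\mathcal{L}_0$. Let $\Omega^1(SU_q(2))$ be the $\mathcal{A}(SU_q(2))$-bimodule that is free as a left module with basis $\omega_+,\omega_-,\omega_z$. The standard holomorphic structure on $\mathcal{L}_k$ is $\overline{\nabla}\phi:=(X_-\triangleright\phi)\,\omega_-$ for $\phi\in\mathcal{L}_k$, and $H^0(\mathcal{L}_k,\overline{\nabla}):=\{\phi\in\mathcal{L}_k:\overline{\nabla}\phi=0\}$ (the holomorphic sections). Continuous version: let $\Gamma(\mathcal{L}_k)$ be the norm closure of $\mathcal{L}_k$ in $C(SU_q(2))$. The Haar state of $SU_q(2)$ extends to a faithful state on $C(SU_q(2))$; let $L^2(SU_q(2))$ be its GNS space and $\eta$ the injective GNS map. There is an orthonormal basis $\{|l,m,n\rangle:l\in\frac12\mathbb{N},\ m,n\in\{-l,\dots,l\}\}$ of $L^2(SU_q(2))$ with $\eta(\mathcal{L}_k)$ equal to the algebraic span of the $|l,m,k/2\rangle$, and $\eta(F\triangleright x)=\sigma(F)\eta(x)$ for $x\in\mathcal{A}(SU_q(2))$, where $\sigma(F)\sum\psi_{lmn}|l,m,n\rangle=\sum\psi_{lmn}\sqrt{[l-n+1][l+n]}|l,m,n-1\rangle$ on $\mathrm{Dom}(\sigma(F))=\{\psi:\sum|\psi_{lmn}|^2[l-n+1][l+n]<\infty\}$.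 A continuous holomorphic section of $\Gamma(\mathcal{L}_k)$ is an $f\in\Gamma(\mathcal{L}_k)$ with $\eta(f)\in\mathrm{Dom}(\sigma(F))$ and $\sigma(F)\eta(f)=0$. *)

theory Defs
  imports "HOL-Analysis.Analysis" "HOL-Library.Poly_Mapping"
begin

definition qnum :: "real \<Rightarrow> real \<Rightarrow> real" where
  "qnum q s = (q powr (-s) - q powr s) / (q powr (-1) - q)"

datatype gen = Ga | Gas | Gc | Gcs

type_synonym fa = "gen list \<Rightarrow>\<^sub>0 complex"

definition wd :: "gen list \<Rightarrow> fa" where "wd w = Poly_Mapping.single w 1"

definition smul :: "complex \<Rightarrow> fa \<Rightarrow> fa" where
  "smul z p = (\<Sum>w\<in>Poly_Mapping.keys p. Poly_Mapping.single w (z * Poly_Mapping.lookup p w))"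

definition fmul :: "fa \<Rightarrow> fa \<Rightarrow> fa" where
  "fmul p r = (\<Sum>u\<in>Poly_Mapping.keys p. \<Sum>v\<in>Poly_Mapping.keys r. Poly_Mapping.single (u @ v) (Poly_Mapping.lookup p u * Poly_Mapping.lookup r v))"

definition fone :: fa where "fone = wd []"

abbreviation "ga \<equiv> wd [Ga]"
abbreviation "gas \<equiv> wd [Gas]"
abbreviation "gc \<equiv> wd [Gc]"
abbreviation "gcs \<equiv> wd [Gcs]"

text \<open>Defining relations of A(SU_q(2)) together with the adjoints of the non-selfadjoint ones
  (the ideal of a *-algebra presentation must be *-closed).\<close>

definition rels :: "real \<Rightarrow> fa set" where
  "rels q = {
     fmul ga gc - smul (complex_of_real q) (fmul gc ga),
     fmul ga gcs - smul (complex_of_real q) (fmul gcs ga),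
     fmul gc gcs - fmul gcs gc,
     fmul gas ga + fmul gcs gc - fone,
     fmul ga gas + smul (complex_of_real (q^2)) (fmul gc gcs) - fone,
     fmul gcs gas - smul (complex_of_real q) (fmul gas gcs),
     fmul gc gas - smul (complex_of_real q) (fmul gas gc) }"

inductive_set ideal_rel :: "real \<Rightarrow> fa set" for q where
  gen: "r \<in> rels q \<Longrightarrow> r \<in> ideal_rel q"
| zero: "0 \<in> ideal_rel q"
| add: "x \<in> ideal_rel q \<Longrightarrow> y \<in> ideal_rel q \<Longrightarrow> x + y \<in> ideal_rel q"
| scal: "x \<in> ideal_rel q \<Longrightarrow> smul z x \<in> ideal_rel q"
| mult: "x \<in> ideal_rel q \<Longrightarrow> fmul (fmul u x) v \<in> ideal_rel q"

definition aeq :: "real \<Rightarrow> fa \<Rightarrow> fa \<Rightarrow> bool" where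
  "aeq q x y \<longleftrightarrow> x - y \<in> ideal_rel q"

section \<open>The left U_q(su(2)) action (module algebra extension of the action on generators)\<close>

datatype uop = UK | UKi | UE | UF

fun act_gen :: "real \<Rightarrow> uop \<Rightarrow> gen \<Rightarrow> fa" where
  "act_gen q UK Ga = smul (complex_of_real (q powr (-1/2))) ga"
| "act_gen q UK Gc = smul (complex_of_real (q powr (-1/2))) gc"
| "act_gen q UK Gas = smul (complex_of_real (q powr (1/2))) gas"
| "act_gen q UK Gcs = smul (complex_of_real (q powr (1/2))) gcs"
| "act_gen q UKi Ga = smul (complex_of_real (q powr (1/2))) ga"
| "act_gen q UKi Gc = smul (complex_of_real (q powr (1/2))) gc"
| "act_gen q UKi Gas = smul (complex_of_real (q powr (-1/2))) gas"
| "act_gen q UKi Gcs = smul (complex_of_real (q powr (-1/2))) gcs"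
| "act_gen q UE Ga = smul (complex_of_real (- q)) gcs"
| "act_gen q UE Gc = gas"
| "act_gen q UE Gas = 0"
| "act_gen q UE Gcs = 0"
| "act_gen q UF Ga = 0"
| "act_gen q UF Gc = 0"
| "act_gen q UF Gas = gc"
| "act_gen q UF Gcs = smul (complex_of_real (- (1/q))) ga"

text \<open>Coproduct: Delta K = K x K, Delta E = E x K + K^{-1} x E, Delta F = F x K + K^{-1} x F;
  counit eps(K)=1, eps(E)=eps(F)=0 (action on the unit).\<close>
fun act_word :: "real \<Rightarrow> uop \<Rightarrow> gen list \<Rightarrow> fa" where
  "act_word q UK [] = fone"
| "act_word q UKi [] = fone"
| "act_word q UE [] = 0"
| "act_word q UF [] = 0"
| "act_word q UK (g # w) = fmul (act_gen q UK g) (act_word q UK w)"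
| "act_word q UKi (g # w) = fmul (act_gen q UKi g) (act_word q UKi w)"
| "act_word q UE (g # w) =
     fmul (act_gen q UE g) (act_word q UK w) + fmul (act_gen q UKi g) (act_word q UE w)"
| "act_word q UF (g # w) =
     fmul (act_gen q UF g) (act_word q UK w) + fmul (act_gen q UKi g) (act_word q UF w)"

definition act :: "real \<Rightarrow> uop \<Rightarrow> fa \<Rightarrow> fa" where
  "act q h p = (\<Sum>w\<in>Poly_Mapping.keys p. smul (Poly_Mapping.lookup p w) (act_word q h w))"

definition act_Xm :: "real \<Rightarrow> fa \<Rightarrow> fa" where
  "act_Xm q p = smul (complex_of_real (q powr (-1/2))) (act q UF (act q UK p))"

definition Lk :: "real \<Rightarrow> int \<Rightarrow> fa set" where
  "Lk q k = {x. aeq q (act q UK x) (smul (complex_of_real (q powr (real_of_int k / 2))) x)}"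

text \<open>Omega^1(SU_q(2)) is free as a left module on omega_+, omega_-, omega_z; an element is given by
  its coefficient triple (omega_+, omega_-, omega_z).  nabla-bar phi = (X_- |> phi) omega_-.\<close>
definition nabla_bar :: "real \<Rightarrow> fa \<Rightarrow> fa \<times> fa \<times> fa" where
  "nabla_bar q \<phi> = (0, act_Xm q \<phi>, 0)"

definition omega_eq :: "real \<Rightarrow> fa \<times> fa \<times> fa \<Rightarrow> fa \<times> fa \<times> fa \<Rightarrow> bool" where
  "omega_eq q u v \<longleftrightarrow> aeq q (fst u) (fst v) \<and> aeq q (fst (snd u)) (fst (snd v))
                        \<and> aeq q (snd (snd u)) (snd (snd v))"

definition H0 :: "real \<Rightarrow> int \<Rightarrow> fa set" where
  "H0 q k = {\<phi> \<in> Lk q k. omega_eq q (nabla_bar q \<phi>) (0, 0, 0)}"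

section \<open>L^2(SU_q(2)) via its orthonormal basis |l,m,n>\<close>

text \<open>Index (l2, m2, n2) stands for (l, m, n) = (l2/2, m2/2, n2/2).\<close>
definition idx :: "(nat \<times> int \<times> int) set" where
  "idx = {(l2, m2, n2). \<bar>m2\<bar> \<le> int l2 \<and> \<bar>n2\<bar> \<le> int l2 \<and> even (int l2 - m2) \<and> even (int l2 - n2)}"

definition l2_vec :: "((nat \<times> int \<times> int) \<Rightarrow> complex) \<Rightarrow> bool" where
  "l2_vec \<psi> \<longleftrightarrow> (\<forall>t. t \<notin> idx \<longrightarrow> \<psi> t = 0) \<and> (\<lambda>t. (cmod (\<psi> t))\<^sup>2) summable_on idx"

definition l2_norm :: "((nat \<times> int \<times> int) \<Rightarrow> complex) \<Rightarrow> real" where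
  "l2_norm \<psi> = sqrt (\<Sum>\<^sub>\<infinity>t\<in>idx. (cmod (\<psi> t))\<^sup>2)"

definition span_k :: "int \<Rightarrow> ((nat \<times> int \<times> int) \<Rightarrow> complex) set" where
  "span_k k = {\<psi>. finite {t. \<psi> t \<noteq> 0} \<and> (\<forall>t. \<psi> t \<noteq> 0 \<longrightarrow> t \<in> idx \<and> snd (snd t) = k)}"

definition wF :: "real \<Rightarrow> nat \<times> int \<times> int \<Rightarrow> real" where
  "wF q t = (case t of (l2, m2, n2) \<Rightarrow>
     qnum q ((real l2 - real_of_int n2) / 2 + 1) * qnum q ((real l2 + real_of_int n2) / 2))"

definition domF :: "real \<Rightarrow> ((nat \<times> int \<times> int) \<Rightarrow> complex) set" where
  "domF q = {\<psi>. l2_vec \<psi> \<and> (\<lambda>t. (cmod (\<psi> t))\<^sup>2 * wF q t) summable_on idx}"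

definition sigmaF :: "real \<Rightarrow> ((nat \<times> int \<times> int) \<Rightarrow> complex) \<Rightarrow> ((nat \<times> int \<times> int) \<Rightarrow> complex)" where
  "sigmaF q \<psi> = (\<lambda>(l2, m2, n2). if (l2, m2, n2 + 2) \<in> idx
       then \<psi> (l2, m2, n2 + 2) * complex_of_real (sqrt (wF q (l2, m2, n2 + 2))) else 0)"

text \<open>A "continuous model": the complex Banach space underlying C(SU_q(2)) (type 'c, complex
  scalar multiplication cs), the inclusion iota of A(SU_q(2)) (given on representatives) and the
  GNS map eta into L^2 = l^2(idx), with the properties listed in the context.\<close>
definition cont_model :: "real \<Rightarrow> (complex \<Rightarrow> 'c::banach \<Rightarrow> 'c) \<Rightarrow> (fa \<Rightarrow> 'c)
     \<Rightarrow> ('c \<Rightarrow> (nat \<times> int \<times> int) \<Rightarrow> complex) \<Rightarrow> bool" where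
  "cont_model q cs \<iota> \<eta> \<longleftrightarrow>
     (\<forall>x. cs 1 x = x) \<and> (\<forall>a b x. cs a (cs b x) = cs (a * b) x)
   \<and> (\<forall>a b x. cs (a + b) x = cs a x + cs b x) \<and> (\<forall>a x y. cs a (x + y) = cs a x + cs a y)
   \<and> (\<forall>r x. cs (complex_of_real r) x = scaleR r x) \<and> (\<forall>a x. norm (cs a x) = cmod a * norm x)
   \<and> (\<forall>x y. \<iota> (x + y) = \<iota> x + \<iota> y) \<and> (\<forall>z x. \<iota> (smul z x) = cs z (\<iota> x))
   \<and> (\<forall>x y. \<iota> x = \<iota> y \<longleftrightarrow> aeq q x y)
   \<and> (\<forall>x y. \<eta> (x + y) = (\<lambda>t. \<eta> x t + \<eta> y t)) \<and> (\<forall>z x. \<eta> (cs z x) = (\<lambda>t. z * \<eta> x t))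
   \<and> inj \<eta> \<and> (\<forall>x. l2_vec (\<eta> x)) \<and> (\<exists>M. \<forall>x. l2_norm (\<eta> x) \<le> M * norm x)
   \<and> (\<forall>k. (\<lambda>x. \<eta> (\<iota> x)) ` Lk q k = span_k k)
   \<and> (\<forall>x. \<eta> (\<iota> (act q UF x)) = sigmaF q (\<eta> (\<iota> x)))"

definition Gamma :: "real \<Rightarrow> (fa \<Rightarrow> 'c::banach) \<Rightarrow> int \<Rightarrow> 'c set" where
  "Gamma q \<iota> k = closure (\<iota> ` Lk q k)"

definition cont_H0 :: "real \<Rightarrow> (fa \<Rightarrow> 'c::banach) \<Rightarrow> ('c \<Rightarrow> (nat \<times> int \<times> int) \<Rightarrow> complex) \<Rightarrow> int \<Rightarrow> 'c set" where
  "cont_H0 q \<iota> \<eta> k = {f \<in> Gamma q \<iota> k. \<eta> f \<in> domF q \<and> sigmaF q (\<eta> f) = (\<lambda>_. 0)}"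

end

theory Submission
  imports Defs
begin

text \<open>Inverting \<open>a\<close> and \<open>c*\<close> embeds \<open>A(SU_q(2))\<close> into a quantum torus in which
  \<open>a* = a^{-1} (1 - q^2 c c*)\<close>. There \<open>F\<close> annihilates \<open>a^i c^j\<close> for every integer \<open>i\<close> and maps
  \<open>a^i c^j c*^k\<close> to a non-zero multiple of \<open>a^{i+1} c^j c*^{k-1}\<close> when \<open>k\<close> is not \<open>0\<close>, so
  its kernel consists of the elements free of \<open>c*\<close>. A negative power of \<open>a\<close> can only enter
  \<open>A(SU_q(2))\<close> through \<open>a*\<close>, hence together with a term containing \<open>c*\<close>; therefore the kernel of
  \<open>F\<close> on \<open>L_k\<close> is spanned by the \<open>a^i c^j\<close> with \<open>i, j >= 0\<close> and \<open>i + j = -k\<close>. For continuous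
  sections the GNS coordinates are continuous, so elements of \<open>Gamma(L_k)\<close> live on the vectors
  \<open>|l, m, k/2>\<close>, and of these \<open>F\<close> kills only those with \<open>k/2 = -l\<close>.\<close>

text \<open>With concatenation as addition on words, the convolution product of \<open>Poly_Mapping\<close> is the product
  of the free algebra.\<close>

instantiation list :: (type) monoid_add
begin

definition zero_list_def: "0 = []"

definition plus_list_def: "xs + ys = xs @ ys"

instance
  by standard (simp_all add: zero_list_def plus_list_def)

end

section \<open>The free algebra as a ring\<close>

text \<open>Scalars are encoded as multiples of the empty word. They are central, so
  \<open>smul\<close> becomes an ordinary ring product.\<close>

definition cst :: "complex \<Rightarrow> fa" where
  "cst z = Poly_Mapping.single [] z"

lemma sum_single_keys: "(\<Sum>w\<in>Poly_Mapping.keys p. Poly_Mapping.single w (Poly_Mapping.lookup p w)) = p"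
  by (rule poly_mapping_eqI) (simp add: lookup_sum lookup_single when_def in_keys_iff)

lemma poly_mapping_single_induct [case_names zero single add]:
  assumes "P 0" and "\<And>w z. P (Poly_Mapping.single w z)" and "\<And>x y. P x \<Longrightarrow> P y \<Longrightarrow> P (x + y)"
  shows "P (p :: 'a \<Rightarrow>\<^sub>0 'b::comm_monoid_add)"
proof -
  have "P (\<Sum>w\<in>A. Poly_Mapping.single w (Poly_Mapping.lookup p w))" if "finite A" for A
    using that by (induction A) (auto intro: assms)
  from this[of "Poly_Mapping.keys p"] show ?thesis
    by (simp add: sum_single_keys)
qed

lemma fmul_eq_times: "fmul p r = p * r"
proof -
  have "p * r = (\<Sum>u\<in>Poly_Mapping.keys p. Poly_Mapping.single u (Poly_Mapping.lookup p u)) *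
                (\<Sum>v\<in>Poly_Mapping.keys r. Poly_Mapping.single v (Poly_Mapping.lookup r v))"
    by (simp add: sum_single_keys)
  also have "\<dots> = fmul p r"
    by (simp add: sum_product mult_single fmul_def plus_list_def)
  finally show ?thesis ..
qed

lemma smul_eq_times: "smul z p = cst z * p"
proof -
  have "cst z * p = cst z * (\<Sum>v\<in>Poly_Mapping.keys p. Poly_Mapping.single v (Poly_Mapping.lookup p v))"
    by (simp add: sum_single_keys)
  also have "\<dots> = smul z p"
    by (simp add: sum_distrib_left mult_single smul_def cst_def plus_list_def)
  finally show ?thesis ..
qed

lemma fone_eq_one: "fone = 1"
  unfolding fone_def wd_def zero_list_def[symmetric] by simp

lemma wd_Nil: "wd [] = 1"
  using fone_eq_one by (simp add: fone_def)

lemma wd_Cons: "wd (g # w) = wd [g] * wd w"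
  by (simp add: wd_def mult_single plus_list_def)

lemma single_eq_cst_wd: "Poly_Mapping.single w z = cst z * wd w"
  by (simp add: wd_def cst_def mult_single plus_list_def)

lemma cst_commute: "p * cst z = cst z * p"
  by (induction p rule: poly_mapping_single_induct)
     (simp_all add: cst_def mult_single plus_list_def algebra_simps)

lemma cst_left_commute: "p * (cst z * r) = cst z * (p * r)"
  by (metis cst_commute mult.assoc)

lemma cst_mult: "cst (y * z) = cst y * cst z"
  by (simp add: cst_def mult_single plus_list_def)

lemma cst_add: "cst (y + z) = cst y + cst z"
  by (simp add: cst_def single_add)

lemma cst_uminus: "cst (- z) = - cst z"
  by (simp add: cst_def single_uminus)

lemma cst_0 [simp]: "cst 0 = 0"
  by (simp add: cst_def)

lemma cst_1 [simp]: "cst 1 = 1"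
  by (simp add: cst_def zero_list_def[symmetric])

section \<open>Congruence modulo the defining ideal\<close>

lemma ideal_rel_cst: "x \<in> ideal_rel q \<Longrightarrow> cst z * x \<in> ideal_rel q"
  using ideal_rel.scal[of x q z] by (simp add: smul_eq_times)

lemma ideal_rel_mult: "x \<in> ideal_rel q \<Longrightarrow> u * x * v \<in> ideal_rel q"
  using ideal_rel.mult[of x q u v] by (simp add: fmul_eq_times)

lemma ideal_rel_uminus: "x \<in> ideal_rel q \<Longrightarrow> - x \<in> ideal_rel q"
  using ideal_rel_cst[of x q "-1"] by (simp add: cst_uminus)

lemma aeq_refl [simp]: "aeq q x x"
  by (simp add: aeq_def ideal_rel.zero)

lemma aeq_sym: "aeq q x y \<Longrightarrow> aeq q y x"
  unfolding aeq_def by (drule ideal_rel_uminus) simp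

lemma aeq_trans [trans]: "aeq q x y \<Longrightarrow> aeq q y z \<Longrightarrow> aeq q x z"
  unfolding aeq_def by (drule (1) ideal_rel.add) simp

lemma aeq_add: "aeq q x x' \<Longrightarrow> aeq q y y' \<Longrightarrow> aeq q (x + y) (x' + y')"
  unfolding aeq_def by (drule (1) ideal_rel.add) (simp add: algebra_simps)

lemma aeq_mult_left: "aeq q x y \<Longrightarrow> aeq q (u * x) (u * y)"
  unfolding aeq_def using ideal_rel_mult[of "x - y" q u 1] by (simp add: algebra_simps)

lemma aeq_mult_right: "aeq q x y \<Longrightarrow> aeq q (x * v) (y * v)"
  unfolding aeq_def using ideal_rel_mult[of "x - y" q 1 v] by (simp add: algebra_simps)

lemma aeq_rels:
  fixes q :: real
  defines "Q \<equiv> cst (complex_of_real q)"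
  shows aeq_a_c: "aeq q (ga * gc) (Q * (gc * ga))"
    and aeq_a_cs: "aeq q (ga * gcs) (Q * (gcs * ga))"
    and aeq_c_cs: "aeq q (gc * gcs) (gcs * gc)"
    and aeq_as_a: "aeq q (gas * ga) (1 - gcs * gc)"
    and aeq_a_as: "aeq q (ga * gas) (1 - Q * (Q * (gc * gcs)))"
    and aeq_cs_as: "aeq q (gcs * gas) (Q * (gas * gcs))"
    and aeq_c_as: "aeq q (gc * gas) (Q * (gas * gc))"
proof -
  have gen: "aeq q x y" if "x - y \<in> rels q" for x y
    using that by (simp add: aeq_def ideal_rel.gen)
  have Q2: "cst (complex_of_real (q\<^sup>2)) = Q * Q"
    by (simp add: Q_def cst_mult[symmetric] power2_eq_square)
  note rels = rels_def fmul_eq_times smul_eq_times fone_eq_one Q2 Q_def[symmetric]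
  show "aeq q (ga * gc) (Q * (gc * ga))" "aeq q (ga * gcs) (Q * (gcs * ga))"
    "aeq q (gc * gcs) (gcs * gc)" "aeq q (gas * ga) (1 - gcs * gc)"
    "aeq q (ga * gas) (1 - Q * (Q * (gc * gcs)))" "aeq q (gcs * gas) (Q * (gas * gcs))"
    "aeq q (gc * gas) (Q * (gas * gc))"
    \<comment> \<open>\<open>diff_diff_eq2\<close> turns x - (1 - y) into x + y - 1, the shape in
      which \<open>rels\<close> lists the two relations containing the unit.\<close>
    by (rule gen, simp only: rels insert_iff mult.assoc diff_diff_eq2 simp_thms)+
qed

section \<open>Representation on the quantum torus\<close>

type_synonym qtorus = "int \<Rightarrow> int \<Rightarrow> int \<Rightarrow> complex"

locale quantum_su2 =
  fixes q :: real
  assumes q_pos: "0 < q" and q_less_1: "q < 1"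
begin

text \<open>A square root of q: the K-weights and all commutation factors are integer powers of
  \<open>s\<close>, written \<open>e i\<close>, so real exponents disappear.\<close>

definition s :: complex where
  "s = complex_of_real (q powr (1/2))"

lemma s_nonzero [simp]: "s \<noteq> 0"
  using q_pos by (simp add: s_def)

definition e :: "int \<Rightarrow> complex" where
  "e i = s powi i"

lemma e_real: "complex_of_real (q powr (real_of_int k / 2)) = e k"
proof -
  have "q powr (real_of_int k / 2) = (q powr (1/2)) powr real_of_int k"
    by (simp add: powr_powr)
  also have "\<dots> = (q powr (1/2)) powi k"
    using q_pos by (subst powr_real_of_int') auto
  finally show ?thesis
    by (simp add: s_def e_def)
qed

lemma s_powers:
  "complex_of_real (q powr (1/2)) = s" "complex_of_real (q powr (-1/2)) = 1 / s"
  "complex_of_real (q powr (- (1/2))) = 1 / s" "complex_of_real q = s\<^sup>2"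
  using e_real[of 1] e_real[of "-1"] e_real[of 2] q_pos
  by (simp_all add: e_def power_int_minus field_simps)

text \<open>Since 0 < q < 1, \<open>s\<close> is not a root of unity. This separates the K-weights
  and decides where the coefficients of F vanish.\<close>

lemma e_inject: "e m = e n \<longleftrightarrow> m = n"
proof
  assume "e m = e n"
  then have "q powr (real_of_int m / 2) = q powr (real_of_int n / 2)"
    unfolding e_real[symmetric] of_real_eq_iff .
  then show "m = n"
    using q_pos q_less_1 by (simp add: powr_inj)
qed simp

lemma e_nonzero [simp]: "e i \<noteq> 0"
  by (simp add: e_def)

lemma e_0 [simp]: "e 0 = 1"
  by (simp add: e_def)

lemma e_add: "e (i + j) = e i * e j"
  by (simp add: e_def power_int_add)

lemma e_of_nat: "e (int m) = s ^ m"
  by (simp add: e_def)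

lemma e_shift [simp]: "e (i + 1) = e i * s" "e (i - 1) = e i / s"
  by (simp_all add: e_def power_int_add power_int_diff)

text \<open>An element is the array of its coefficients with respect to the monomials
  \<open>a^i c^j c*^k\<close>, where \<open>a\<close>, \<open>c\<close>, \<open>c*\<close> are invertible and \<open>a* = a^{-1} (1 - q^2 c c*)\<close>.\<close>
fun lmul :: "gen \<Rightarrow> qtorus \<Rightarrow> qtorus" where
  "lmul Ga f = (\<lambda>i j k. f (i - 1) j k)"
| "lmul Gc f = (\<lambda>i j k. f i (j - 1) k / e i ^ 2)"
| "lmul Gcs f = (\<lambda>i j k. f i j (k - 1) / e i ^ 2)"
| "lmul Gas f = (\<lambda>i j k. f (i + 1) j k - f (i + 1) (j - 1) (k - 1) / e i ^ 4)"

abbreviation lmul_word :: "gen list \<Rightarrow> qtorus \<Rightarrow> qtorus" where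
  "lmul_word \<equiv> foldr lmul"

text \<open>Left multiplication, extended linearly to the free algebra. The factors
  \<open>e i ^ 2\<close> = q^i in \<open>lmul\<close> come from c a^i = q^{-i} a^i c and its
  analogue for c*. Arrays of infinite support are allowed, so no finiteness has to be carried
  along.\<close>

definition rho :: "fa \<Rightarrow> qtorus \<Rightarrow> qtorus" where
  "rho x f = (\<lambda>i j k. \<Sum>w\<in>Poly_Mapping.keys x. Poly_Mapping.lookup x w * lmul_word w f i j k)"

definition unit_vec :: qtorus where
  "unit_vec = (\<lambda>i j k. if i = 0 \<and> j = 0 \<and> k = 0 then 1 else 0)"

text \<open>Acting on the unit recovers the coefficients of the image of \<open>x\<close> in the
  quantum torus.\<close>

definition symbol :: "fa \<Rightarrow> qtorus" where
  "symbol x = rho x unit_vec"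

lemma rho_0 [simp]: "rho 0 f i j k = 0"
  by (simp add: rho_def)

lemma rho_add: "rho (x + y) f i j k = rho x f i j k + rho y f i j k"
  unfolding rho_def by (rule setsum_keys_plus_distrib) (simp_all add: algebra_simps)

lemma rho_single: "rho (Poly_Mapping.single w z) f i j k = z * lmul_word w f i j k"
  by (simp add: rho_def)

lemma lmul_linear:
  "lmul g (\<lambda>i j k. z * f i j k + h i j k) = (\<lambda>i j k. z * lmul g f i j k + lmul g h i j k)"
  by (cases g) (auto simp: algebra_simps add_divide_distrib diff_divide_distrib)

lemma lmul_word_linear:
  "lmul_word w (\<lambda>i j k. z * f i j k + h i j k) = (\<lambda>i j k. z * lmul_word w f i j k + lmul_word w h i j k)"
  by (induction w) (simp_all add: lmul_linear)

lemma lmul_word_add: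
  "lmul_word w (\<lambda>i j k. f i j k + h i j k) = (\<lambda>i j k. lmul_word w f i j k + lmul_word w h i j k)"
  using lmul_word_linear[of w 1] by simp

lemma lmul_word_0: "lmul_word w (\<lambda>i j k. 0) = (\<lambda>i j k. 0)"
proof (induction w)
  case (Cons g w) then show ?case by (cases g) auto
qed simp

lemma lmul_word_scale:
  "lmul_word w (\<lambda>i j k. z * f i j k) = (\<lambda>i j k. z * lmul_word w f i j k)"
  using lmul_word_linear[of w z f "\<lambda>i j k. 0"] by (simp add: lmul_word_0)

lemma rho_zero_vec: "rho x (\<lambda>i j k. 0) = (\<lambda>i j k. 0)"
  by (simp add: rho_def lmul_word_0)

lemma rho_mult: "rho (x * y) f = rho x (rho y f)"
proof (induction x rule: poly_mapping_single_induct)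
  case (single w z)
  show ?case
  proof (induction y rule: poly_mapping_single_induct)
    case (single v z')
    show ?case
      by (intro ext) (simp add: mult_single rho_single plus_list_def lmul_word_scale)
  next
    case (add x y)
    then show ?case
      by (auto simp: fun_eq_iff rho_add distrib_left rho_single lmul_word_add)
  qed (auto simp: fun_eq_iff rho_single lmul_word_0)
qed (auto simp: fun_eq_iff rho_add distrib_right)

lemma rho_cst: "rho (cst z) f i j k = z * f i j k"
  by (simp add: cst_def rho_single)

lemma rho_uminus: "rho (- x) f i j k = - rho x f i j k"
proof -
  have "- x = cst (-1) * x"
    by (simp only: cst_uminus cst_1) simp
  then show ?thesis
    by (simp add: rho_mult rho_cst)
qed

lemma rho_diff: "rho (x - y) f i j k = rho x f i j k - rho y f i j k"
  using rho_add[of x "- y"] by (simp add: rho_uminus)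

lemma rho_wd: "rho (wd w) f = lmul_word w f"
  by (intro ext) (simp add: wd_def rho_single)

lemma rho_1: "rho 1 f = f"
  using rho_wd[of "[]"] by (simp add: wd_Nil)

text \<open>Coefficientwise, each relation is an identity between weighted shifts; hence
  \<open>rho\<close> descends to A(SU_q(2)).\<close>

lemma rho_rels:
  assumes "r \<in> rels q"
  shows "rho r f = (\<lambda>i j k. 0)"
  using assms unfolding rels_def
  by (elim insertE emptyE; hypsubst)
     (simp_all add: fun_eq_iff fmul_eq_times smul_eq_times fone_eq_one rho_add rho_diff rho_mult
      rho_wd rho_cst rho_1 s_powers, simp_all add: field_simps eval_nat_numeral)

lemma rho_ideal:
  assumes "x \<in> ideal_rel q"
  shows "rho x f = (\<lambda>i j k. 0)"
  using assms
proof (induction arbitrary: f)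
  case (mult x u v)
  then show ?case
    by (simp add: fmul_eq_times rho_mult rho_zero_vec)
qed (auto simp: rho_rels fun_eq_iff rho_add smul_eq_times rho_mult rho_cst)

lemma symbol_aeq: "aeq q x y \<Longrightarrow> symbol x = symbol y"
  unfolding aeq_def symbol_def by (drule rho_ideal[of _ unit_vec]) (auto simp: fun_eq_iff rho_diff)

lemma symbol_add: "symbol (x + y) i j k = symbol x i j k + symbol y i j k"
  by (simp add: symbol_def rho_add)

lemma symbol_0 [simp]: "symbol 0 i j k = 0"
  by (simp add: symbol_def)

lemma symbol_diff: "symbol (x - y) i j k = symbol x i j k - symbol y i j k"
  by (simp add: symbol_def rho_diff)

lemma symbol_cst: "symbol (cst z * x) i j k = z * symbol x i j k"
  by (simp add: symbol_def rho_mult rho_cst)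

lemma symbol_sum: "symbol (\<Sum>t\<in>T. f t) i j k = (\<Sum>t\<in>T. symbol (f t) i j k)"
  by (induction T rule: infinite_finite_induct) (simp_all add: symbol_add)

lemma symbol_mult: "symbol (x * y) = rho x (symbol y)"
  by (simp add: symbol_def rho_mult)

lemma symbol_expand:
  "symbol x i j k = (\<Sum>w\<in>Poly_Mapping.keys x. Poly_Mapping.lookup x w * symbol (wd w) i j k)"
  by (simp add: symbol_def rho_def[of x] rho_wd)


section \<open>K and F as operators on symbols\<close>

lemma s4_neq_1: "s ^ 4 \<noteq> 1"
  using e_inject[of 4 0] by (simp add: e_def)

text \<open>Here a and c have weight q^{-1/2} and c* has q^{1/2}; then a*, of degree -1 in a, gets
  q^{1/2} as required.\<close>

definition Kop :: "qtorus \<Rightarrow> qtorus" where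
  "Kop f = (\<lambda>i j k. e k / (e i * e j) * f i j k)"

text \<open>The weight is read off from \<open>F(a^i c^j) = 0\<close>, \<open>F(c*) = - q^{-1} a\<close> and the twisted Leibniz rule.\<close>
definition Fop :: "qtorus \<Rightarrow> qtorus" where
  "Fop f = (\<lambda>i j k. s / (1 - s ^ 4) * (e (i - 1) / e j) * (e (k + 1) - 1 / e (k + 1) ^ 3) * f (i - 1) j (k + 1))"

lemma rho_act_gen_K: "rho (act_gen q UK g) (Kop f) = Kop (lmul g f)"
  by (cases g) (auto simp: fun_eq_iff Kop_def smul_eq_times rho_mult rho_wd rho_cst s_powers field_simps)

text \<open>The coproduct rule for F on a product with one generator in front, which is the
  induction step for words. The case of a* is the laborious one because its symbol has two
  terms.\<close>

lemma rho_act_gen_F: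
  "rho (act_gen q UF g) (Kop f) i j k + rho (act_gen q UKi g) (Fop f) i j k = Fop (lmul g f) i j k"
proof (cases "g = Gas")
  case True
  define D where "D = 1 - s ^ 4"
  define u where "u = e k - 1 / e k ^ 3"
  define v where "v = s * e k - 1 / (s * e k) ^ 3"
  have D: "D \<noteq> 0"
    using s4_neq_1 by (simp add: D_def)
  \<comment> \<open>u and v are the F-weights at c*-exponents k and k + 1. This combination cancels
    the inverse cubes, so the term produced by \<open>act_gen q UF Gas\<close> can be absorbed into
    the other two.\<close>
  have "e k * (s * D) = s * u - s ^ 4 * v"
    by (simp add: D_def u_def v_def field_simps eval_nat_numeral)
  then have ek: "e k = (s * u - s ^ 4 * v) / (s * D)"
    using D by (simp add: field_simps)
  have "rho (act_gen q UF g) (Kop f) i j k + rho (act_gen q UKi g) (Fop f) i j k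
      = e k / (e i * (e j / s)) * f i (j - 1) k / e i ^ 2
        + 1 / s * (s / D * (e i / e j) * v * f i j (k + 1)
        - s / D * (e i / (e j / s)) * u * f i (j - 1) k / e i ^ 4)"
    by (simp add: True Kop_def Fop_def rho_wd smul_eq_times rho_mult rho_cst s_powers D_def u_def v_def mult_ac)
  also have "\<dots> = s / D * ((e i / s) / e j) * v * (f i j (k + 1) - f i (j - 1) k / (e i / s) ^ 4)"
    using D unfolding ek by (simp add: field_simps eval_nat_numeral)
  also have "\<dots> = Fop (lmul g f) i j k"
    by (simp add: True Fop_def D_def v_def mult.commute)
  finally show ?thesis .
next
  case False
  then show ?thesis
    using s4_neq_1
    by (cases g) (simp_all add: Kop_def Fop_def smul_eq_times rho_mult rho_wd rho_cst s_powers field_simps eval_nat_numeral)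
qed

lemma symbol_1: "symbol 1 = unit_vec"
  by (simp add: symbol_def rho_1)

lemma symbol_act_word_K: "symbol (act_word q UK w) = Kop (symbol (wd w))"
proof (induction w)
  case Nil
  show ?case
    by (auto simp: fone_eq_one wd_Nil symbol_1 Kop_def unit_vec_def fun_eq_iff)
next
  case (Cons g w)
  then show ?case
    by (simp add: fmul_eq_times symbol_mult wd_Cons[of g w] rho_wd rho_act_gen_K)
qed

lemma symbol_act_word_F: "symbol (act_word q UF w) = Fop (symbol (wd w))"
proof (induction w)
  case Nil
  \<comment> \<open>Only k = -1 meets the support of \<open>unit_vec\<close>, and there the weight
    \<open>e 0 - 1 / e 0 ^ 3\<close> is zero.\<close>
  have "Fop unit_vec i j k = 0" for i j k
    using e_0 by (cases "k = -1") (auto simp: Fop_def unit_vec_def simp del: e_shift)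
  then show ?case
    by (auto simp: wd_Nil symbol_1 fun_eq_iff)
next
  case (Cons g w)
  then show ?case
    by (intro ext) (simp add: fmul_eq_times symbol_add symbol_mult wd_Cons[of g w] rho_wd
        symbol_act_word_K rho_act_gen_F)
qed

lemma symbol_act:
  "symbol (act q h p) i j k = (\<Sum>w\<in>Poly_Mapping.keys p. Poly_Mapping.lookup p w * symbol (act_word q h w) i j k)"
  by (simp add: act_def symbol_sum smul_eq_times symbol_cst)

lemma symbol_act_K: "symbol (act q UK p) = Kop (symbol p)"
  by (intro ext) (simp add: symbol_act symbol_act_word_K symbol_expand[of p] Kop_def sum_distrib_left mult_ac)

lemma symbol_act_F: "symbol (act q UF p) = Fop (symbol p)"
  by (intro ext) (simp add: symbol_act symbol_act_word_F symbol_expand[of p] Fop_def sum_distrib_left mult.left_commute mult.assoc del: times_divide_eq_left times_divide_eq_right)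

section \<open>The Poincare-Birkhoff-Witt basis\<close>

text \<open>Negative exponents encode powers of a*. A normal form needs a or a* but never both,
  since a a* and a* a reduce to polynomials in c and c*.\<close>

definition apow :: "int \<Rightarrow> fa" where
  "apow i = (if 0 \<le> i then ga ^ nat i else gas ^ nat (- i))"

fun mon :: "int \<times> nat \<times> nat \<Rightarrow> fa" where
  "mon (i, j, k) = apow i * (gc ^ j * gcs ^ k)"

definition emb :: "(int \<times> nat \<times> nat \<Rightarrow>\<^sub>0 complex) \<Rightarrow> fa" where
  "emb p = (\<Sum>t\<in>Poly_Mapping.keys p. cst (Poly_Mapping.lookup p t) * mon t)"

lemma emb_0 [simp]: "emb 0 = 0"
  by (simp add: emb_def)

lemma emb_single: "emb (Poly_Mapping.single t z) = cst z * mon t"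
  by (simp add: emb_def)

lemma emb_add: "emb (p + r) = emb p + emb r"
  unfolding emb_def by (rule setsum_keys_plus_distrib) (simp_all add: cst_add distrib_right)

lemma twisted_commute_power:
  assumes "aeq q (x * y) (cst z * (y * x))"
  shows "aeq q (x * y ^ n) (cst (z ^ n) * (y ^ n * x))"
proof (induction n)
  case (Suc n)
  have "aeq q (x * y ^ Suc n) (cst z * (y * x) * y ^ n)"
    using aeq_mult_right[OF assms, of "y ^ n"] by (simp add: mult.assoc)
  also have "cst z * (y * x) * y ^ n = cst z * y * (x * y ^ n)"
    by (simp add: mult.assoc)
  also have "aeq q \<dots> (cst z * y * (cst (z ^ n) * (y ^ n * x)))"
    by (rule aeq_mult_left[OF Suc])
  also have "\<dots> = cst (z ^ Suc n) * (y ^ Suc n * x)"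
    by (simp add: mult.assoc cst_left_commute[of y] cst_mult)
  finally show ?case .
qed simp

lemma cst_cancel: "z \<noteq> 0 \<Longrightarrow> cst (inverse z) * (cst z * x) = x"
  by (simp add: mult.assoc[symmetric] cst_mult[symmetric])

lemma twisted_commute_swap:
  assumes "aeq q (x * y) (cst z * (y * x))" "z \<noteq> 0"
  shows "aeq q (y * x) (cst (inverse z) * (x * y))"
  using aeq_sym[OF aeq_mult_left[OF assms(1), of "cst (inverse z)"]] assms(2) by (simp add: cst_cancel)

text \<open>One formula covers both signs of \<open>i\<close>: moving c or c* to the right past a
  costs q^{-1}, past a* it costs q, and \<open>e i ^ 2\<close> is q^i.\<close>

lemma c_commute_apow:
  assumes "x = gc \<or> x = gcs"
  shows "aeq q (x * apow i) (cst (1 / e i ^ 2) * (apow i * x))"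
proof (cases "0 \<le> i")
  case True
  have "aeq q (ga * x) (cst (s\<^sup>2) * (x * ga))"
    using assms aeq_a_c[of q] aeq_a_cs[of q] by (auto simp: s_powers)
  then have "aeq q (x * ga) (cst (inverse (s\<^sup>2)) * (ga * x))"
    by (rule twisted_commute_swap) simp
  from twisted_commute_power[OF this, of "nat i"] True show ?thesis
    using e_of_nat[of "nat i"] by (simp add: apow_def field_simps flip: power_mult)
next
  case False
  have "aeq q (x * gas) (cst (s\<^sup>2) * (gas * x))"
    using assms aeq_c_as[of q] aeq_cs_as[of q] by (auto simp: s_powers)
  moreover have "e i * e (- i) = 1"
    by (simp add: e_add[symmetric])
  then have "s ^ nat (- i) = 1 / e i"
    using e_of_nat[of "nat (- i)"] False by (simp add: field_simps)
  then have "(s\<^sup>2) ^ nat (- i) = 1 / e i ^ 2"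
    by (metis power_mult mult.commute power_one_over)
  ultimately show ?thesis
    using twisted_commute_power[of x gas "s\<^sup>2" "nat (- i)"] False
    by (simp add: apow_def)
qed

lemma aeq_c_mon: "aeq q (gc * mon (i, j, k)) (cst (1 / e i ^ 2) * mon (i, Suc j, k))"
  using aeq_mult_right[OF c_commute_apow[of gc i], of "gc ^ j * gcs ^ k"] by (simp add: mult.assoc)

lemma aeq_cs_mon: "aeq q (gcs * mon (i, j, k)) (cst (1 / e i ^ 2) * mon (i, j, Suc k))"
proof -
  have "aeq q (gcs * gc) (cst 1 * (gc * gcs))"
    using aeq_sym[OF aeq_c_cs] by simp
  from twisted_commute_power[OF this, of j]
  have "aeq q (gcs * gc ^ j) (gc ^ j * gcs)"
    by simp
  then have *: "aeq q (gcs * gc ^ j * gcs ^ k) (gc ^ j * gcs * gcs ^ k)"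
    by (rule aeq_mult_right)
  have "aeq q (gcs * mon (i, j, k)) (cst (1 / e i ^ 2) * (apow i * gcs) * (gc ^ j * gcs ^ k))"
    using aeq_mult_right[OF c_commute_apow[of gcs i], of "gc ^ j * gcs ^ k"] by (simp add: mult.assoc)
  also have "\<dots> = cst (1 / e i ^ 2) * apow i * (gcs * gc ^ j * gcs ^ k)"
    by (simp add: mult.assoc)
  also have "aeq q \<dots> (cst (1 / e i ^ 2) * apow i * (gc ^ j * gcs * gcs ^ k))"
    by (rule aeq_mult_left[OF *])
  finally show ?thesis
    by (simp add: mult.assoc)
qed

text \<open>For negative \<open>i\<close> the leading a meets an a* and leaves 1 - q^2 c c* in
  front. The factors c and c* stay on the left, where closure of the normal forms under
  \<open>gc\<close> and \<open>gcs\<close> deals with them.\<close>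

lemma aeq_a_mon:
  "aeq q (ga * mon (i, j, k)) (if 0 \<le> i then mon (i + 1, j, k)
     else mon (i + 1, j, k) - cst (q ^ 2) * (gc * (gcs * mon (i + 1, j, k))))"
proof (cases "0 \<le> i")
  case True
  then have "apow (i + 1) = ga * apow i"
    by (simp add: apow_def nat_add_distrib)
  then show ?thesis
    using True by (simp add: mult.assoc)
next
  case False
  then have "nat (- i) = Suc (nat (- (i + 1)))"
    by linarith
  then have "apow i = gas * apow (i + 1)"
    using False by (auto simp: apow_def)
  then have "ga * mon (i, j, k) = ga * gas * mon (i + 1, j, k)"
    by (simp add: mult.assoc)
  also have "aeq q \<dots> ((1 - cst q * (cst q * (gc * gcs))) * mon (i + 1, j, k))"
    by (rule aeq_mult_right[OF aeq_a_as])
  also have "\<dots> = mon (i + 1, j, k) - cst (q ^ 2) * (gc * (gcs * mon (i + 1, j, k)))"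
    by (simp add: left_diff_distrib mult.assoc cst_mult power2_eq_square)
  finally show ?thesis
    using False by simp
qed

lemma aeq_as_mon:
  "aeq q (gas * mon (i, j, k)) (if i \<le> 0 then mon (i - 1, j, k)
     else mon (i - 1, j, k) - gcs * (gc * mon (i - 1, j, k)))"
proof (cases "i \<le> 0")
  case True
  then have "nat (- (i - 1)) = Suc (nat (- i))"
    by linarith
  then have "apow (i - 1) = gas * apow i"
    using True by (auto simp: apow_def)
  then show ?thesis
    using True by (simp add: mult.assoc)
next
  case False
  then have "nat i = Suc (nat (i - 1))"
    by linarith
  then have "apow i = ga * apow (i - 1)"
    using False by (auto simp: apow_def)
  then have "gas * mon (i, j, k) = gas * ga * mon (i - 1, j, k)"
    by (simp add: mult.assoc)
  also have "aeq q \<dots> ((1 - gcs * gc) * mon (i - 1, j, k))"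
    by (rule aeq_mult_right[OF aeq_as_a])
  also have "\<dots> = mon (i - 1, j, k) - gcs * (gc * mon (i - 1, j, k))"
    by (simp add: left_diff_distrib mult.assoc)
  finally show ?thesis
    using False by simp
qed

section \<open>Reduction to normal form\<close>

definition reducible :: "fa \<Rightarrow> bool" where
  "reducible x \<longleftrightarrow> (\<exists>p. aeq q x (emb p))"

lemma reducible_aeq: "aeq q x y \<Longrightarrow> reducible y \<Longrightarrow> reducible x"
  unfolding reducible_def using aeq_trans by blast

lemma reducible_emb: "reducible (emb p)"
  unfolding reducible_def using aeq_refl by blast

lemma reducible_mon: "reducible (mon t)"
  using reducible_emb[of "Poly_Mapping.single t 1"] by (simp add: emb_single)

lemma reducible_add: "reducible x \<Longrightarrow> reducible y \<Longrightarrow> reducible (x + y)"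
  unfolding reducible_def by (metis aeq_add emb_add)

lemma reducible_cst:
  assumes "reducible x"
  shows "reducible (cst z * x)"
proof -
  obtain p where p: "aeq q x (emb p)"
    using assms by (auto simp: reducible_def)
  have "reducible (cst z * emb p)"
  proof (induction p rule: poly_mapping_single_induct)
    case (single t y)
    show ?case
      using reducible_emb[of "Poly_Mapping.single t (z * y)"] by (simp add: emb_single cst_mult mult.assoc)
  next
    case zero
    show ?case
      using reducible_emb[of 0] by simp
  qed (simp_all add: emb_add distrib_left reducible_add)
  then show ?thesis
    using reducible_aeq aeq_mult_left[OF p] by blast
qed

lemma reducible_diff: "reducible x \<Longrightarrow> reducible y \<Longrightarrow> reducible (x - y)"
  using reducible_add[OF _ reducible_cst[of y "-1"], of x] by (simp add: cst_uminus)

lemma reducible_mult: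
  assumes "\<And>t. reducible (u * mon t)" "reducible x"
  shows "reducible (u * x)"
proof -
  obtain p where p: "aeq q x (emb p)"
    using assms by (auto simp: reducible_def)
  have "reducible (u * emb p)"
  proof (induction p rule: poly_mapping_single_induct)
    case (single t y)
    show ?case
      by (simp add: emb_single cst_left_commute[of u] reducible_cst assms(1))
  next
    case zero
    show ?case
      using reducible_emb[of 0] by simp
  qed (simp_all add: emb_add distrib_left reducible_add)
  then show ?thesis
    using reducible_aeq aeq_mult_left[OF p] by blast
qed

lemma reducible_c: "reducible x \<Longrightarrow> reducible (gc * x)"
proof (erule reducible_mult[rotated])
  show "reducible (gc * mon t)" for t
    using aeq_c_mon reducible_aeq reducible_cst reducible_mon by (cases t) blast
qed

lemma reducible_cs: "reducible x \<Longrightarrow> reducible (gcs * x)"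
proof (erule reducible_mult[rotated])
  show "reducible (gcs * mon t)" for t
    using aeq_cs_mon reducible_aeq reducible_cst reducible_mon by (cases t) blast
qed

lemma reducible_a: "reducible x \<Longrightarrow> reducible (ga * x)"
proof (erule reducible_mult[rotated])
  fix t :: "int \<times> nat \<times> nat"
  obtain i j k where t: "t = (i, j, k)"
    by (cases t)
  show "reducible (ga * mon t)"
    unfolding t by (rule reducible_aeq[OF aeq_a_mon])
      (simp only: reducible_mon reducible_diff reducible_cst reducible_c reducible_cs split: if_split, simp)
qed

lemma reducible_as: "reducible x \<Longrightarrow> reducible (gas * x)"
proof (erule reducible_mult[rotated])
  fix t :: "int \<times> nat \<times> nat"
  obtain i j k where t: "t = (i, j, k)"
    by (cases t)
  show "reducible (gas * mon t)"
    unfolding t by (rule reducible_aeq[OF aeq_as_mon])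
      (simp only: reducible_mon reducible_diff reducible_c reducible_cs split: if_split, simp)
qed

text \<open>Modulo the ideal, the span of the normal monomials contains 1 and is stable under left
  multiplication by every generator, so it contains every word.\<close>

lemma reducible_all: "reducible x"
proof (induction x rule: poly_mapping_single_induct)
  case (single w z)
  have "reducible (wd w)"
  proof (induction w)
    case Nil
    show ?case
      using reducible_mon[of "(0, 0, 0)"] by (simp add: wd_Nil apow_def)
  next
    case (Cons g w)
    then show ?case
      by (cases g) (simp_all add: wd_Cons[of _ w] reducible_a reducible_as reducible_c reducible_cs)
  qed
  then show ?case
    by (simp add: single_eq_cst_wd reducible_cst)
next
  case zero
  show ?case
    using reducible_emb[of 0] by simp
qed (simp add: reducible_add)


section \<open>Faithfulness and the kernel of F\<close>

lemma symbol_gen_mult: "symbol (wd [g] * x) = lmul g (symbol x)"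
  by (simp add: symbol_mult rho_wd)

lemma symbol_c_cs_power:
  "symbol (gc ^ j * gcs ^ k) = (\<lambda>a b c. if a = 0 \<and> b = int j \<and> c = int k then 1 else 0)"
proof (induction j)
  case 0
  have "symbol (gcs ^ k) = (\<lambda>a b c. if a = 0 \<and> b = 0 \<and> c = int k then 1 else 0)"
    by (induction k) (auto simp: symbol_1 unit_vec_def symbol_gen_mult fun_eq_iff)
  then show ?case
    by simp
next
  case (Suc j)
  then show ?case
    by (auto simp: mult.assoc symbol_gen_mult fun_eq_iff)
qed

lemma symbol_mon_nonneg:
  assumes "0 \<le> i"
  shows "symbol (mon (i, j, k)) = (\<lambda>a b c. if a = i \<and> b = int j \<and> c = int k then 1 else 0)"
proof -
  have "symbol (ga ^ n * (gc ^ j * gcs ^ k)) = (\<lambda>a b c. if a = int n \<and> b = int j \<and> c = int k then 1 else 0)" for n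
    by (induction n) (auto simp: symbol_c_cs_power mult.assoc symbol_gen_mult fun_eq_iff)
  from this[of "nat i"] show ?thesis
    using assms by (simp add: apow_def)
qed

text \<open>In the torus a*^m is a^{-m} times a polynomial of degree m in c c*, so the support lies
  on a diagonal segment whose top end carries a nonzero coefficient.\<close>

lemma symbol_as_power:
  defines "x \<equiv> \<lambda>m j k. gas ^ m * (gc ^ j * gcs ^ k)"
  shows "symbol (x m j k) a b c \<noteq> 0 \<Longrightarrow> a = - int m \<and> (\<exists>u\<le>m. b = int j + int u \<and> c = int k + int u)"
    and "symbol (x m j k) (- int m) (int j + int m) (int k + int m) \<noteq> 0"
proof -
  have "(symbol (x m j k) a b c \<noteq> 0 \<longrightarrow> a = - int m \<and> (\<exists>u\<le>m. b = int j + int u \<and> c = int k + int u)) \<and>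
        symbol (x m j k) (- int m) (int j + int m) (int k + int m) \<noteq> 0" for a b c
  proof (induction m arbitrary: a b c)
    case 0
    show ?case
      by (simp add: x_def symbol_c_cs_power)
  next
    case (Suc m)
    define g where "g = symbol (x m j k)"
    have step: "symbol (x (Suc m) j k) a b c = g (a + 1) b c - g (a + 1) (b - 1) (c - 1) / e a ^ 4" for a b c
      by (simp add: x_def g_def mult.assoc symbol_gen_mult)
    have supp: "a = - int m \<and> (\<exists>u\<le>m. b = int j + int u \<and> c = int k + int u)" if "g a b c \<noteq> 0" for a b c
      using Suc.IH[of a b c] that by (simp add: g_def)
    have "a = - int (Suc m) \<and> (\<exists>u\<le>Suc m. b = int j + int u \<and> c = int k + int u)"
      if "symbol (x (Suc m) j k) a b c \<noteq> 0"
    proof -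
      from that consider "g (a + 1) b c \<noteq> 0" | "g (a + 1) (b - 1) (c - 1) \<noteq> 0"
        unfolding step by fastforce
      then show ?thesis
      proof cases
        case 1
        from supp[OF this] show ?thesis
          by (auto intro: le_SucI)
      next
        case 2
        from supp[OF this] obtain u where "a + 1 = - int m" "u \<le> m" "b - 1 = int j + int u" "c - 1 = int k + int u"
          by blast
        then show ?thesis
          by (intro conjI exI[of _ "Suc u"]) auto
      qed
    qed
    \<comment> \<open>The array for m stops at u = m, so the new top coefficient comes from the
      shifted summand alone.\<close>
    moreover have "g (- int m) (int j + int (Suc m)) (int k + int (Suc m)) = 0"
      using supp[of "- int m" "int j + int (Suc m)" "int k + int (Suc m)"] by fastforce
    then have "symbol (x (Suc m) j k) (- int (Suc m)) (int j + int (Suc m)) (int k + int (Suc m)) \<noteq> 0"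
      using Suc.IH unfolding step g_def[symmetric] by simp
    ultimately show ?case
      by blast
  qed
  then show "symbol (x m j k) a b c \<noteq> 0 \<Longrightarrow> a = - int m \<and> (\<exists>u\<le>m. b = int j + int u \<and> c = int k + int u)"
    and "symbol (x m j k) (- int m) (int j + int m) (int k + int m) \<noteq> 0"
    by blast+
qed

text \<open>For \<open>0 \<le> i\<close> the bound \<open>nat (- i)\<close> is 0, so powers of a and
  of a* are treated uniformly.\<close>

lemma symbol_mon_support:
  assumes "symbol (mon (i, j, k)) a b c \<noteq> 0"
  obtains u where "a = i" "u \<le> nat (- i)" "b = int j + int u" "c = int k + int u"
proof (cases "0 \<le> i")
  case True
  then show ?thesis
    using assms that[of 0] by (auto simp only: symbol_mon_nonneg split: if_splits)
next
  case False
  then show ?thesis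
    using assms that symbol_as_power(1)[of "nat (- i)" j k a b c] by (auto simp: apow_def)
qed

lemma symbol_mon_top: "symbol (mon (i, j, k)) i (int j + int (nat (- i))) (int k + int (nat (- i))) \<noteq> 0"
  using symbol_as_power(2)[of "nat (- i)" j k] symbol_mon_nonneg[of i j k]
  by (cases "0 \<le> i") (simp_all add: apow_def)

lemma symbol_emb:
  "symbol (emb p) a b c = (\<Sum>t\<in>Poly_Mapping.keys p. Poly_Mapping.lookup p t * symbol (mon t) a b c)"
  by (simp add: emb_def symbol_sum symbol_cst)

text \<open>Among the monomials to be excluded, one with maximal \<open>c\<close>-exponent has a top term that
  nothing else can cancel.\<close>
lemma keys_of_c_star_free:
  assumes "\<And>a b c. symbol (emb p) a b c \<noteq> 0 \<Longrightarrow> c = 0" and "(i, j, k) \<in> Poly_Mapping.keys p"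
  shows "0 \<le> i \<and> k = 0"
proof (rule ccontr)
  define B where "B = {(i, j, k). (i, j, k) \<in> Poly_Mapping.keys p \<and> (i < 0 \<or> 0 < k)}"
  assume "\<not> (0 \<le> i \<and> k = 0)"
  then have "B \<noteq> {}"
    using assms(2) by (fastforce simp: B_def)
  moreover have "finite B"
    by (rule finite_subset[of _ "Poly_Mapping.keys p"]) (auto simp: B_def)
  ultimately have "Max ((\<lambda>t. fst (snd t)) ` B) \<in> (\<lambda>t. fst (snd t)) ` B"
    by (intro Max_in) auto
  then obtain i j k where t: "(i, j, k) \<in> B" and "j = Max ((\<lambda>t. fst (snd t)) ` B)"
    by force
  then have max: "j' \<le> j" if "(i', j', k') \<in> B" for i' j' k'
    using \<open>finite B\<close> that by (force intro!: Max_ge)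
  define m where "m = nat (- i)"
  \<comment> \<open>If t' lies in \<open>B\<close>, maximality of j forces u = m and then t' = (i,
    j, k). Otherwise t' has nonnegative first and zero third exponent, so m = 0 and again t' = (i,
    j, k).\<close>
  have "symbol (mon t') i (int j + int m) (int k + int m) = 0"
    if "t' \<in> Poly_Mapping.keys p" "t' \<noteq> (i, j, k)" for t'
  proof (rule ccontr)
    assume *: "symbol (mon t') i (int j + int m) (int k + int m) \<noteq> 0"
    obtain i' j' k' where t': "t' = (i', j', k')"
      by (cases t')
    obtain u where u: "i' = i" "u \<le> m" "int j + int m = int j' + int u" "int k + int m = int k' + int u"
      using symbol_mon_support[OF *[unfolded t']] unfolding m_def by metis
    show False
    proof (cases "t' \<in> B")
      case True
      then have "j' \<le> j"
        using max t' by blast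
      then show ?thesis
        using u that t' by auto
    next
      case False
      then have "m = 0"
        using u that t' by (auto simp: B_def m_def)
      then show ?thesis
        using u that t' by auto
    qed
  qed
  then have "symbol (emb p) i (int j + int m) (int k + int m) = (\<Sum>t\<in>{(i, j, k)}.
      Poly_Mapping.lookup p t * symbol (mon t) i (int j + int m) (int k + int m))"
    unfolding symbol_emb using t by (intro sum.mono_neutral_right) (auto simp: B_def simp del: mon.simps)
  also have "\<dots> = Poly_Mapping.lookup p (i, j, k) * symbol (mon (i, j, k)) i (int j + int m) (int k + int m)"
    by simp
  finally have "symbol (emb p) i (int j + int m) (int k + int m) = \<dots>" .
  moreover have "\<dots> \<noteq> 0"
    using t symbol_mon_top[of i j k] by (auto simp: B_def m_def in_keys_iff simp del: mon.simps)
  \<comment> \<open>The uncancelled term has c*-exponent k + m, which membership in \<open>B\<close>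
    makes positive.\<close>
  ultimately have "int k + int m = 0"
    using assms(1) by metis
  then show False
    using t by (auto simp: B_def m_def split: if_splits)
qed

lemma symbol_emb_nonneg:
  assumes "\<And>t. t \<in> Poly_Mapping.keys p \<Longrightarrow> 0 \<le> fst t"
  shows "symbol (emb p) i (int j) (int k) = Poly_Mapping.lookup p (i, j, k)"
proof -
  have "Poly_Mapping.lookup p t * symbol (mon t) i (int j) (int k) =
      (if t = (i, j, k) then Poly_Mapping.lookup p t else 0)"
    if "t \<in> Poly_Mapping.keys p" for t
    using assms[OF that] by (cases t) (auto simp: symbol_mon_nonneg simp del: mon.simps)
  then show ?thesis
    by (simp add: symbol_emb in_keys_iff)
qed

text \<open>The representation is faithful: a vanishing symbol satisfies the assumption of
  \<open>keys_of_c_star_free\<close> vacuously, so the normal form of x - y contains no a*. Its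
  coefficients are then symbol values, hence zero.\<close>

lemma aeq_iff_symbol: "aeq q x y \<longleftrightarrow> symbol x = symbol y"
proof
  assume eq: "symbol x = symbol y"
  obtain p where p: "aeq q (x - y) (emb p)"
    using reducible_all by (auto simp: reducible_def)
  then have z: "symbol (emb p) a b c = 0" for a b c
    using symbol_aeq[OF p] eq by (metis symbol_diff right_minus_eq)
  then have "0 \<le> i" if "(i, j, k) \<in> Poly_Mapping.keys p" for i j k
    using keys_of_c_star_free[OF _ that] by auto
  then have "Poly_Mapping.lookup p (i, j, k) = 0" for i j k
    using symbol_emb_nonneg[of p i j k] z by force
  then have "p = 0"
    by (intro poly_mapping_eqI) auto
  then show "aeq q x y"
    using p by (simp add: aeq_def)
qed (rule symbol_aeq)

section \<open>Holomorphic sections of \<open>Lk\<close>\<close>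

text \<open>K is diagonal on symbols, and by \<open>e_inject\<close> distinct degrees c - a - b have
  distinct eigenvalues.\<close>

lemma Lk_iff: "x \<in> Lk q k \<longleftrightarrow> (\<forall>a b c. symbol x a b c \<noteq> 0 \<longrightarrow> c - a - b = k)"
proof -
  have "e c / (e a * e b) = e (c - a - b)" for a b c
    using e_add[of "c - a - b" "a + b"] by (simp add: e_add field_simps)
  then have "x \<in> Lk q k \<longleftrightarrow> (\<forall>a b c. e (c - a - b) * symbol x a b c = e k * symbol x a b c)"
    by (simp add: Lk_def aeq_iff_symbol symbol_act_K e_real smul_eq_times fun_eq_iff symbol_cst Kop_def)
  then show ?thesis
    by (auto simp: e_inject)
qed

text \<open>Up to a nonzero scalar X_- is F after K. F moves the coefficient at c*-exponent n to n -
  1 with a nonzero multiple of \<open>e n - 1 / e n ^ 3\<close>, which vanishes only for n =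
  0.\<close>

lemma H0_iff: "x \<in> H0 q k \<longleftrightarrow> x \<in> Lk q k \<and> (\<forall>a b c. symbol x a b c \<noteq> 0 \<longrightarrow> c = 0)"
proof -
  have "e n - 1 / e n ^ 3 = 0 \<longleftrightarrow> n = 0" for n
  proof -
    have "e n - 1 / e n ^ 3 = 0 \<longleftrightarrow> e n * e n * e n * e n = 1"
      by (auto simp: field_simps eval_nat_numeral)
    also have "e n * e n * e n * e n = e (4 * n)"
      by (simp add: e_add[symmetric])
    finally show ?thesis
      using e_inject[of "4 * n" 0] by simp
  qed
  then have "Fop (Kop f) a b c = 0 \<longleftrightarrow> c + 1 = 0 \<or> f (a - 1) b (c + 1) = 0" for f a b c
    using s4_neq_1 by (simp add: Fop_def Kop_def del: e_shift)
  then have "aeq q (act_Xm q x) 0 \<longleftrightarrow> (\<forall>a b c. c + 1 = 0 \<or> symbol x (a - 1) b (c + 1) = 0)"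
    by (simp add: act_Xm_def aeq_iff_symbol smul_eq_times fun_eq_iff symbol_cst symbol_act_F symbol_act_K s_powers)
  also have "\<dots> \<longleftrightarrow> (\<forall>a b c. symbol x a b c \<noteq> 0 \<longrightarrow> c = 0)"
    by (metis add_diff_cancel diff_add_cancel)
  finally show ?thesis
    by (simp add: H0_def omega_eq_def nabla_bar_def)
qed

lemma H0_expansion:
  assumes "x \<in> H0 q k"
  obtains p where "aeq q x (emb p)" "\<forall>(i, j, l)\<in>Poly_Mapping.keys p. 0 \<le> i \<and> l = 0 \<and> i + int j = - k"
proof -
  obtain p where p: "aeq q x (emb p)"
    using reducible_all by (auto simp: reducible_def)
  have *: "c = 0 \<and> - a - b = k" if "symbol (emb p) a b c \<noteq> 0" for a b c
    using assms that unfolding H0_iff Lk_iff symbol_aeq[OF p] by fastforce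
  have keys: "0 \<le> i \<and> l = 0" if "(i, j, l) \<in> Poly_Mapping.keys p" for i j l
    using keys_of_c_star_free[OF _ that] * by blast
  \<comment> \<open>With no a* left, coefficients equal symbol values, so the degree condition on
    the support passes to the keys.\<close>
  have deg: "i + int j = - k" if "(i, j, l) \<in> Poly_Mapping.keys p" for i j l
  proof -
    have "symbol (emb p) i (int j) (int l) = Poly_Mapping.lookup p (i, j, l)"
      using keys by (intro symbol_emb_nonneg) force
    then show ?thesis
      using *[of i "int j" "int l"] that by (auto simp: in_keys_iff)
  qed
  have "\<forall>(i, j, l)\<in>Poly_Mapping.keys p. 0 \<le> i \<and> l = 0 \<and> i + int j = - k"
  proof clarify
    fix i j l assume "(i, j, l) \<in> Poly_Mapping.keys p"
    from keys[OF this] deg[OF this] show "0 \<le> i \<and> l = 0 \<and> i + int j = - k"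
      by simp
  qed
  with p show ?thesis
    by (rule that)
qed

text \<open>The exponents in the expansion would be nonnegative with the negative sum -n, so the
  expansion is empty.\<close>

lemma H0_positive:
  assumes "0 < n" "x \<in> H0 q (int n)"
  shows "aeq q x 0"
proof -
  obtain p where p: "aeq q x (emb p)"
    and keys: "\<forall>(i, j, l)\<in>Poly_Mapping.keys p. 0 \<le> i \<and> l = 0 \<and> i + int j = - int n"
    by (rule H0_expansion[OF assms(2)])
  have "Poly_Mapping.keys p = {}"
    using keys assms(1) by fastforce
  then show ?thesis
    using p by (simp add: emb_def)
qed

text \<open>For i \<le> n these are the n + 1 monomials a^i c^{n-i}, the future basis of
  H^0(L_{-n}).\<close>

definition hol :: "nat \<Rightarrow> nat \<Rightarrow> fa" where
  "hol n i = mon (int i, n - i, 0)"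

lemma symbol_hol:
  "symbol (hol n i) = (\<lambda>a b c. if a = int i \<and> b = int (n - i) \<and> c = 0 then 1 else 0)"
  using symbol_mon_nonneg[of "int i" "n - i" 0] by (simp add: hol_def del: mon.simps)

lemma hol_in_H0: "i \<le> n \<Longrightarrow> hol n i \<in> H0 q (- int n)"
  by (auto simp: H0_iff Lk_iff symbol_hol)

lemma symbol_hol_sum:
  assumes "i \<le> n"
  shows "symbol (\<Sum>i\<le>n. smul (c i) (hol n i)) (int i) (int (n - i)) 0 = c i"
proof -
  have "symbol (\<Sum>i\<le>n. smul (c i) (hol n i)) (int i) (int (n - i)) 0 = (\<Sum>i'\<le>n. if i' = i then c i' else 0)"
    unfolding symbol_sum smul_eq_times symbol_cst symbol_hol using assms by (intro sum.cong) auto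
  then show ?thesis
    using assms by simp
qed

lemma H0_negative:
  assumes "x \<in> H0 q (- int n)"
  shows "\<exists>!c. (\<forall>i>n. c i = 0) \<and> aeq q x (\<Sum>i\<le>n. smul (c i) (hol n i))"
proof -
  obtain p where p: "aeq q x (emb p)"
    and keys: "\<forall>(i, j, l)\<in>Poly_Mapping.keys p. 0 \<le> i \<and> l = 0 \<and> i + int j = - (- int n)"
    by (rule H0_expansion[OF assms])
  define h where "h = (\<lambda>i. (int i, n - i, 0::nat))"
  \<comment> \<open>The value 0 beyond n makes the coefficients unique as a function on all natural
    numbers.\<close>
  define c where "c = (\<lambda>i. if i \<le> n then Poly_Mapping.lookup p (h i) else 0)"
  have "Poly_Mapping.keys p \<subseteq> h ` {..n}"
  proof clarify
    fix i j l assume "(i, j, l) \<in> Poly_Mapping.keys p"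
    with keys have "0 \<le> i \<and> l = 0 \<and> i + int j = int n"
      by auto
    then show "(i, j, l) \<in> h ` {..n}"
      by (intro image_eqI[of _ _ "nat i"]) (auto simp: h_def)
  qed
  then have "emb p = (\<Sum>t\<in>h ` {..n}. cst (Poly_Mapping.lookup p t) * mon t)"
    unfolding emb_def by (intro sum.mono_neutral_left) (auto simp: in_keys_iff)
  also have "\<dots> = (\<Sum>i\<le>n. smul (c i) (hol n i))"
    by (subst sum.reindex) (auto simp: inj_on_def h_def c_def hol_def smul_eq_times simp del: mon.simps intro!: sum.cong)
  finally have ex: "aeq q x (\<Sum>i\<le>n. smul (c i) (hol n i))"
    using p by simp
  show ?thesis
  proof (rule ex1I[of _ c])
    show "(\<forall>i>n. c i = 0) \<and> aeq q x (\<Sum>i\<le>n. smul (c i) (hol n i))"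
      using ex by (simp add: c_def)
  next
    fix d assume d: "(\<forall>i>n. d i = 0) \<and> aeq q x (\<Sum>i\<le>n. smul (d i) (hol n i))"
    show "d = c"
    proof
      fix i
      have "symbol (\<Sum>i\<le>n. smul (d i) (hol n i)) = symbol (\<Sum>i\<le>n. smul (c i) (hol n i))"
        using d ex by (metis symbol_aeq)
      then show "d i = c i"
        using d symbol_hol_sum[of i n d] symbol_hol_sum[of i n c] by (cases "i \<le> n") (auto simp: c_def)
    qed
  qed
qed

end

section \<open>Continuous sections\<close>

lemma qnum_pos:
  assumes "0 < q" "q < 1" "0 < x"
  shows "0 < qnum q x"
proof -
  have *: "q powr y < q powr (- y)" if "0 < y" for y
    using assms that by (simp add: powr_less_mono')
  from *[OF \<open>0 < x\<close>] *[of 1] assms show ?thesis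
    by (simp add: qnum_def)
qed

text \<open>With l and n half the stored indices, [l - n + 1] is positive for all n \<le> l, whereas
  [l + n] vanishes only at n = -l.\<close>

lemma wF_eq_0_iff:
  assumes "0 < q" "q < 1" "(l, m, k) \<in> idx"
  shows "wF q (l, m, k) = 0 \<longleftrightarrow> k = - int l"
proof -
  have k: "- int l \<le> k" "k \<le> int l"
    using assms(3) by (auto simp: idx_def)
  have "0 < qnum q ((real l - real_of_int k) / 2 + 1)"
    using k by (intro qnum_pos assms) (simp add: field_simps)
  moreover have "0 < qnum q ((real l + real_of_int k) / 2)" if "k \<noteq> - int l"
    using k that by (intro qnum_pos assms) auto
  moreover have "qnum q ((real l + real_of_int k) / 2) = 0" if "k = - int l"
    using that assms by (simp add: qnum_def)
  ultimately show ?thesis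
    by (cases "k = - int l") (simp_all add: wF_def)
qed

text \<open>F is a weighted shift, so it kills exactly the vectors supported where the weight
  vanishes. Stored indices are doubled, hence the shift by 2.\<close>

lemma sigmaF_eq_0_iff:
  assumes "0 < q" "q < 1" "\<And>t. t \<notin> idx \<Longrightarrow> \<psi> t = 0"
  shows "sigmaF q \<psi> = (\<lambda>_. 0) \<longleftrightarrow> (\<forall>l m k. \<psi> (l, m, k) \<noteq> 0 \<longrightarrow> k = - int l)"
proof -
  have "sigmaF q \<psi> = (\<lambda>_. 0) \<longleftrightarrow> (\<forall>l m k. (l, m, k + 2) \<in> idx \<longrightarrow> \<psi> (l, m, k + 2) = 0 \<or> k + 2 = - int l)"
    using wF_eq_0_iff[OF assms(1,2)] by (auto simp: sigmaF_def fun_eq_iff)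
  also have "\<dots> \<longleftrightarrow> (\<forall>l m k. (l, m, k) \<in> idx \<longrightarrow> \<psi> (l, m, k) = 0 \<or> k = - int l)"
    by (metis diff_add_cancel)
  finally show ?thesis
    using assms(3) by blast
qed

lemma cmod_le_l2_norm:
  assumes "l2_vec \<psi>"
  shows "cmod (\<psi> t) \<le> l2_norm \<psi>"
proof (cases "t \<in> idx")
  case True
  have "(\<Sum>t\<in>{t}. (cmod (\<psi> t))\<^sup>2) \<le> (\<Sum>\<^sub>\<infinity>t\<in>idx. (cmod (\<psi> t))\<^sup>2)"
    using assms True by (intro finite_sum_le_infsum) (auto simp: l2_vec_def)
  then show ?thesis
    by (simp add: l2_norm_def real_le_rsqrt)
next
  case False
  then show ?thesis
    using assms by (simp only: l2_vec_def l2_norm_def simp_thms) (simp add: infsum_nonneg)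
qed

section \<open>Coordinates in a continuous model\<close>

context
  fixes q :: real and cs :: "complex \<Rightarrow> 'c::banach \<Rightarrow> 'c" and \<iota> \<eta>
  assumes q: "0 < q" "q < 1" and model: "cont_model q cs \<iota> \<eta>"
begin

lemma eta_add: "\<eta> (x + y) t = \<eta> x t + \<eta> y t"
  and eta_cs: "\<eta> (cs z x) t = z * \<eta> x t"
  and eta_inj: "\<eta> x = \<eta> y \<longleftrightarrow> x = y"
  and eta_l2: "l2_vec (\<eta> x)"
  and eta_bounded: "\<exists>M. \<forall>x. l2_norm (\<eta> x) \<le> M * norm x"
  and eta_Lk: "(\<lambda>x. \<eta> (\<iota> x)) ` Lk q k = span_k k"
proof -
  note m = model[unfolded cont_model_def]
  have "\<forall>x y. \<eta> (x + y) = (\<lambda>t. \<eta> x t + \<eta> y t)" "\<forall>z x. \<eta> (cs z x) = (\<lambda>t. z * \<eta> x t)" "inj \<eta>"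
    using m by - (elim conjE, assumption)+
  then show "\<eta> (x + y) t = \<eta> x t + \<eta> y t" "\<eta> (cs z x) t = z * \<eta> x t" "\<eta> x = \<eta> y \<longleftrightarrow> x = y"
    by (simp_all add: inj_eq)
  have "\<forall>x. l2_vec (\<eta> x)" "\<exists>M. \<forall>x. l2_norm (\<eta> x) \<le> M * norm x"
    "\<forall>k. (\<lambda>x. \<eta> (\<iota> x)) ` Lk q k = span_k k"
    using m by - (elim conjE, assumption)+
  then show "l2_vec (\<eta> x)" "\<exists>M. \<forall>x. l2_norm (\<eta> x) \<le> M * norm x"
    "(\<lambda>x. \<eta> (\<iota> x)) ` Lk q k = span_k k"
    by blast+
qed

lemma eta_0 [simp]: "\<eta> 0 t = 0"
  using eta_add[of 0 0 t] by simp

lemma eta_diff: "\<eta> (x - y) t = \<eta> x t - \<eta> y t"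
  using eta_add[of "x - y" y t] by simp

lemma eta_sum: "\<eta> (\<Sum>i\<in>I. f i) t = (\<Sum>i\<in>I. \<eta> (f i) t)"
  by (induction I rule: infinite_finite_induct) (simp_all add: eta_add)

lemma eta_idx: "t \<notin> idx \<Longrightarrow> \<eta> x t = 0"
  using eta_l2[of x] unfolding l2_vec_def by blast

lemma eta_eqI: "(\<And>t. \<eta> x t = \<eta> y t) \<Longrightarrow> x = y"
  by (simp add: eta_inj[symmetric] fun_eq_iff)

text \<open>A coordinate is bounded by the l^2 norm, hence by a multiple of the norm of its
  argument; additivity turns this into a Lipschitz bound.\<close>

lemma continuous_eta: "continuous_on UNIV (\<lambda>x. \<eta> x t)"
proof -
  obtain M where M: "l2_norm (\<eta> x) \<le> M * norm x" for x
    using eta_bounded by blast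
  have "cmod (\<eta> x t - \<eta> y t) \<le> \<bar>M\<bar> * norm (x - y)" for x y
  proof -
    have "cmod (\<eta> x t - \<eta> y t) \<le> M * norm (x - y)"
      using cmod_le_l2_norm[OF eta_l2, of "x - y" t] M[of "x - y"] by (simp add: eta_diff)
    \<comment> \<open>M comes without a sign condition, but a Lipschitz constant must be
      nonnegative.\<close>
    also have "\<dots> \<le> \<bar>M\<bar> * norm (x - y)"
      by (intro mult_right_mono) auto
    finally show ?thesis .
  qed
  then have "\<bar>M\<bar>-lipschitz_on UNIV (\<lambda>x. \<eta> x t)"
    by (intro lipschitz_onI) (auto simp: dist_norm)
  then show ?thesis
    by (rule lipschitz_on_continuous_on)
qed

text \<open>Vanishing of one coordinate is a closed condition, so it passes from \<open>Lk\<close>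
  to its closure.\<close>

lemma eta_Gamma:
  assumes "f \<in> Gamma q \<iota> k" "\<eta> f (l, m, k') \<noteq> 0"
  shows "k' = k"
proof (rule ccontr)
  assume "k' \<noteq> k"
  have "closure (\<iota> ` Lk q k) \<subseteq> {x. \<eta> x (l, m, k') = 0}"
  proof (rule closure_minimal)
    show "closed {x. \<eta> x (l, m, k') = 0}"
      using continuous_eta by (intro closed_Collect_eq) auto
    show "\<iota> ` Lk q k \<subseteq> {x. \<eta> x (l, m, k') = 0}"
    proof clarify
      fix x assume "x \<in> Lk q k"
      then have "\<eta> (\<iota> x) \<in> span_k k"
        using eta_Lk[of k] by blast
      then show "\<eta> (\<iota> x) (l, m, k') = 0"
        using \<open>k' \<noteq> k\<close> by (auto simp: span_k_def)
    qed
  qed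
  then show False
    using assms by (auto simp: Gamma_def)
qed

text \<open>Membership in \<open>Gamma\<close> fixes the weight, and the kernel of F forces it to be
  lowest. Positive \<open>k\<close> therefore leaves no coordinate.\<close>

lemma eta_cont_H0:
  assumes "f \<in> cont_H0 q \<iota> \<eta> k" "\<eta> f (l, m, k') \<noteq> 0"
  shows "k' = k \<and> int l = - k"
proof -
  have f: "f \<in> Gamma q \<iota> k" "sigmaF q (\<eta> f) = (\<lambda>_. 0)"
    using assms(1) by (simp_all add: cont_H0_def)
  have "k' = - int l"
    using f(2) assms(2) sigmaF_eq_0_iff[OF q, of "\<eta> f"] eta_idx by blast
  with eta_Gamma[OF f(1) assms(2)] show ?thesis
    by simp
qed

lemma cont_H0_positive:
  assumes "0 < n" "f \<in> cont_H0 q \<iota> \<eta> (int n)"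
  shows "f = 0"
proof (rule eta_eqI)
  fix t
  show "\<eta> f t = \<eta> 0 t"
    using eta_cont_H0[OF assms(2)] assms(1) by (cases t) force
qed

text \<open>Undoubled, these are |n/2, i - n/2, -n/2>, the lowest-weight vectors with l =
  n/2.\<close>

definition lowest :: "nat \<Rightarrow> nat \<Rightarrow> nat \<times> int \<times> int" where
  "lowest n i = (n, 2 * int i - int n, - int n)"

lemma lowest_exhaust:
  assumes "(n, m, - int n) \<in> idx"
  obtains i where "i \<le> n" "(n, m, - int n) = lowest n i"
proof -
  from assms have m: "\<bar>m\<bar> \<le> int n" "even (int n - m)"
    by (auto simp: idx_def)
  then have "even (m + int n)"
    by presburger
  then obtain r where r: "m + int n = 2 * r"
    by blast
  show ?thesis
    using that[of "nat r"] m r by (auto simp: lowest_def)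
qed

text \<open>The model puts all of \<open>span_k\<close> into the image of \<open>Lk\<close>, so
  these vectors come from algebraic sections; finite support settles the domain condition.\<close>

lemma ex_lowest_section:
  assumes "i \<le> n"
  shows "\<exists>b. b \<in> cont_H0 q \<iota> \<eta> (- int n) \<and> \<eta> b = (\<lambda>t. if t = lowest n i then 1 else 0)"
proof -
  define \<delta> :: "nat \<times> int \<times> int \<Rightarrow> complex" where "\<delta> = (\<lambda>t. if t = lowest n i then 1 else 0)"
  have "\<delta> \<in> span_k (- int n)"
    using assms by (auto simp: \<delta>_def span_k_def lowest_def idx_def)
  then obtain x where x: "x \<in> Lk q (- int n)" "\<eta> (\<iota> x) = \<delta>"
    using eta_Lk[of "- int n"] by (metis (no_types, lifting) imageE)
  have "\<iota> x \<in> Gamma q \<iota> (- int n)"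
    using x(1) closure_subset[of "\<iota> ` Lk q (- int n)"] by (auto simp: Gamma_def)
  moreover have "(\<lambda>t. (cmod (\<delta> t))\<^sup>2 * wF q t) summable_on idx"
    by (rule finite_nonzero_values_imp_summable_on, rule finite_subset[of _ "{lowest n i}"]) (auto simp: \<delta>_def)
  then have "\<eta> (\<iota> x) \<in> domF q"
    using eta_l2[of "\<iota> x"] x(2) by (simp add: domF_def)
  moreover have "sigmaF q (\<eta> (\<iota> x)) = (\<lambda>_. 0)"
    by (subst sigmaF_eq_0_iff[OF q eta_idx]) (auto simp: x(2) \<delta>_def lowest_def)
  ultimately show ?thesis
    using x(2) by (auto simp: cont_H0_def \<delta>_def)
qed

text \<open>Nonzero coordinates occur only at the n + 1 indices \<open>lowest n i\<close>, and
  \<open>\<eta>\<close> is injective, so the sections dual to these indices form a basis.\<close>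

lemma cont_H0_negative:
  "\<exists>b. (\<forall>i\<le>n. b i \<in> cont_H0 q \<iota> \<eta> (- int n))
     \<and> (\<forall>f\<in>cont_H0 q \<iota> \<eta> (- int n). \<exists>!c. (\<forall>i>n. c i = 0) \<and> f = (\<Sum>i\<le>n. cs (c i) (b i)))"
proof -
  obtain b where b: "b i \<in> cont_H0 q \<iota> \<eta> (- int n)" "\<eta> (b i) = (\<lambda>t. if t = lowest n i then 1 else 0)"
    if "i \<le> n" for i
    using ex_lowest_section[of _ n] by metis
  have lowest_inject: "lowest n i = lowest n j \<longleftrightarrow> i = j" for i j
    by (auto simp: lowest_def)
  have coord: "\<eta> (\<Sum>i\<le>n. cs (c i) (b i)) (lowest n i) = c i" if "i \<le> n" for c i
  proof -
    have "\<eta> (\<Sum>i\<le>n. cs (c i) (b i)) (lowest n i) = (\<Sum>j\<le>n. if j = i then c j else 0)"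
      unfolding eta_sum eta_cs using that by (intro sum.cong) (auto simp: b(2) lowest_inject)
    then show ?thesis
      using that by simp
  qed
  have "\<exists>!c. (\<forall>i>n. c i = 0) \<and> f = (\<Sum>i\<le>n. cs (c i) (b i))" if f: "f \<in> cont_H0 q \<iota> \<eta> (- int n)" for f
  proof (rule ex1I)
    \<comment> \<open>By \<open>coord\<close> the coordinates of f are the only possible
      coefficients.\<close>
    let ?c = "\<lambda>i. if i \<le> n then \<eta> f (lowest n i) else 0"
    have "f = (\<Sum>i\<le>n. cs (?c i) (b i))"
    proof (rule eta_eqI)
      fix t
      show "\<eta> f t = \<eta> (\<Sum>i\<le>n. cs (?c i) (b i)) t"
      proof (cases "\<exists>i\<le>n. t = lowest n i")
        case True
        then show ?thesis
          using coord[of _ ?c] by auto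
      next
        case False
        then have "\<eta> (\<Sum>i\<le>n. cs (?c i) (b i)) t = 0"
          by (auto simp: eta_sum eta_cs b(2) intro!: sum.neutral)
        moreover have "\<eta> f t = 0"
        proof (rule ccontr)
          assume nz: "\<eta> f t \<noteq> 0"
          obtain l m k where t: "t = (l, m, k)"
            by (cases t)
          have "l = n" "k = - int n"
            using eta_cont_H0[OF f, of l m k] nz t by auto
          then show False
            using False eta_idx[of t f] nz t lowest_exhaust[of n m] by metis
        qed
        ultimately show ?thesis
          by simp
      qed
    qed
    then show "(\<forall>i>n. ?c i = 0) \<and> f = (\<Sum>i\<le>n. cs (?c i) (b i))"
      by simp
    fix d assume "(\<forall>i>n. d i = 0) \<and> f = (\<Sum>i\<le>n. cs (d i) (b i))"
    then show "d = ?c"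
      using coord[of _ d] by (intro ext) (metis not_le_imp_less)
  qed
  with b(1) show ?thesis
    by blast
qed

end

theorem theorem4p4:
  fixes q :: real and n :: nat
  assumes "0 < q" and "q < 1" and "0 < n"
  shows "(\<forall>\<phi>\<in>H0 q (int n). aeq q \<phi> 0)
       \<and> (\<exists>b. (\<forall>i\<le>n. b i \<in> H0 q (- int n))
              \<and> (\<forall>\<phi>\<in>H0 q (- int n). \<exists>!c. (\<forall>i>n. c i = 0)
                     \<and> aeq q \<phi> (\<Sum>i\<le>n. smul (c i) (b i))))
       \<and> (\<forall>(cs :: complex \<Rightarrow> 'c::banach \<Rightarrow> 'c) \<iota> \<eta>. cont_model q cs \<iota> \<eta> \<longrightarrow>
             (\<forall>f\<in>cont_H0 q \<iota> \<eta> (int n). f = 0)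
           \<and> (\<exists>b. (\<forall>i\<le>n. b i \<in> cont_H0 q \<iota> \<eta> (- int n))
                 \<and> (\<forall>f\<in>cont_H0 q \<iota> \<eta> (- int n). \<exists>!c. (\<forall>i>n. c i = 0)
                        \<and> f = (\<Sum>i\<le>n. cs (c i) (b i)))))"
proof -
  interpret quantum_su2 q
    using assms by unfold_locales
  show ?thesis
  proof (intro conjI allI impI)
    show "\<forall>\<phi>\<in>H0 q (int n). aeq q \<phi> 0"
      using H0_positive[OF assms(3)] by blast
    show "\<exists>b. (\<forall>i\<le>n. b i \<in> H0 q (- int n)) \<and> (\<forall>\<phi>\<in>H0 q (- int n). \<exists>!c. (\<forall>i>n. c i = 0)
        \<and> aeq q \<phi> (\<Sum>i\<le>n. smul (c i) (b i)))"
      using hol_in_H0[of _ n] H0_negative[of _ n] by (intro exI[of _ "hol n"]) simp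
  next
    fix cs :: "complex \<Rightarrow> 'c \<Rightarrow> 'c" and \<iota> \<eta>
    assume model: "cont_model q cs \<iota> \<eta>"
    show "\<forall>f\<in>cont_H0 q \<iota> \<eta> (int n). f = 0"
      using cont_H0_positive[OF assms(1,2) model assms(3)] by blast
    show "\<exists>b. (\<forall>i\<le>n. b i \<in> cont_H0 q \<iota> \<eta> (- int n)) \<and> (\<forall>f\<in>cont_H0 q \<iota> \<eta> (- int n).
        \<exists>!c. (\<forall>i>n. c i = 0) \<and> f = (\<Sum>i\<le>n. cs (c i) (b i)))"
      by (rule cont_H0_negative[OF assms(1,2) model])
  qed
qed

end
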